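(* Let $d\ge2$, let $\lambda>0$, and let $\{P_t:t\ge0\}$ be the semigroup of the coalescing random walks process on $\mathcal{S}_{d-1}$ with generator $L$, where $Lf(\eta)=\lambda\int_{\mathbb{R}^{d-1}}[f((\eta\setminus B(u))\cup\{u\})-f(\eta)]\,du$. There is a constant $C_d\in(0,\infty)$ depending only on the dimension such that for every bounded function $f:\mathcal{S}_{d-1}\to\mathbb{R}$ with finite support there exists a finite constant $C(f)$ with $$\bigl\Vert P_tf-E[f]\bigr\Vert_\infty\le C(f)\,e^{-C_d\lambda t}\qquad\text{for every } t\ge0,$$ where $E[\,\cdot\,]$ is the expectation with respect to the stationary state (the unique invariant measure of the process).
   Context: $\mathcal{S}_{d-1}$ is the set of locally finite configurations (subsets) of $\mathbb{R}^{d-1}$; $f$ has finite support if there is a bounded $\Lambda\subset\mathbb{R}^{d-1}$ with $f(\eta)=f(\eta\cap\Lambda)$ for all $\eta$; $\Vert\cdot\Vert_\infty$ is the supremum norm over $\mathcal{S}_{d-1}$; $B(u)=\{x\in\mathbb{R}^{d-1}:|x-u|\le1\}$. The process is constructed as follows. Let $S$ be a Poisson process in $\mathbb{R}^d=\mathbb{R}^{d-1}\times\mathbb{R}$ with intensity $\lambda$. For $(x,r)\in\mathbb{R}^{d-1}\times\mathbb{R}$ let $\alpha(x,r)$ be the (a.s. unique) point $(x',r')\in S$ with $|x-x'|\le1$, $r'>r$ and $r'$ minimal. For $s=(x,r)$ put $x(s)=x$, $r(s)=r$, $\alpha^0(s)=s$, $\alpha^n(s)=\alpha(\alpha^{n-1}(s))$,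 $\tau^n(s)=r(\alpha^n(s))$, and $X^{(x,r)}_t=x(\alpha^n(x,r))$ for $t\in[\tau^n(x,r),\tau^{n+1}(x,r))$, $n\ge0$. The process started from $\eta\in\mathcal{S}_{d-1}$ at time $0$ is $$\eta^{\eta}_t=\{X^{(x,r)}_t:\ (x,r)\in S\text{ with }0\le r\le t,\ \text{or } x\in\eta\text{ and } r=0\},$$ it is Markov with generator $L$, and $P_tf(\eta)=\mathbb{E}[f(\eta^{\eta}_t)]$. Its unique invariant measure is the law of $\{X^{(x,r)}_0:(x,r)\in S,\ r\le0\}$. *)

theory Defs
  imports "HOL-Probability.Probability"
begin

text \<open>The space \<open>\<real>\<^sup>d\<^sup>-\<^sup>1\<close> with \<open>d \<ge> 2\<close> is a type \<open>'a :: euclidean_space\<close> with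
  \<open>DIM('a) = d - 1\<close>; space-time \<open>\<real>\<^sup>d\<close> is \<open>'a \<times> real\<close>, the second component being time.\<close>

definition configurations :: "'b::euclidean_space set set" where
  "configurations = {\<eta>. \<forall>\<Lambda>. bounded \<Lambda> \<longrightarrow> finite (\<eta> \<inter> \<Lambda>)}"

definition config_space :: "'b::euclidean_space set measure" where
  "config_space = sigma configurations
     {{\<eta> \<in> configurations. card (\<eta> \<inter> A) = k} | A k. A \<in> sets borel \<and> bounded A}"

text \<open>\<open>N\<close> is the law of a homogeneous Poisson process of intensity \<open>l\<close>. The processes below are
  functions of the Poisson process only, so we work on the canonical space, where an outcome
  is the locally finite set \<open>S\<close> of Poisson points itself.\<close>

definition poisson_law :: "real \<Rightarrow> 'b::euclidean_space set measure \<Rightarrow> bool" where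
  "poisson_law l N \<longleftrightarrow>
     prob_space N \<and> sets N = sets config_space \<and>
     (\<forall>A k. A \<in> sets borel \<and> bounded A \<longrightarrow>
        measure N {S \<in> space N. card (S \<inter> A) = k} =
          exp (- (l * measure lborel A)) * (l * measure lborel A) ^ k / fact k) \<and>
     (\<forall>I (A :: nat \<Rightarrow> 'b set).
        finite I \<and> disjoint_family_on A I \<and> (\<forall>i\<in>I. A i \<in> sets borel \<and> bounded (A i)) \<longrightarrow>
        prob_space.indep_vars N (\<lambda>_. count_space UNIV) (\<lambda>i S. card (S \<inter> A i)) I)"

definition next_point :: "('a::euclidean_space \<times> real) set \<Rightarrow> 'a \<times> real \<Rightarrow> 'a \<times> real" where
  "next_point S s =
     arg_min snd (\<lambda>s'. s' \<in> S \<and> norm (fst s - fst s') \<le> 1 \<and> snd s < snd s')"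

text \<open>The set of positions at time \<open>t\<close> of the walks started at the space-time points in \<open>I\<close>: the
  walk from \<open>s\<close> sits at the location of the \<open>n\<close>-th iterate \<open>\<alpha>\<^sup>n(s)\<close> during
  \<open>[\<tau>\<^sup>n(s), \<tau>\<^sup>n\<^sup>+\<^sup>1(s))\<close>, where \<open>\<tau>\<^sup>n(s)\<close> is the time component of \<open>\<alpha>\<^sup>n(s)\<close>. Almost surely
  the required \<open>n\<close> exists whenever \<open>s\<close> starts no later than \<open>t\<close>; a walk without such an \<open>n\<close> has
  no position at time \<open>t\<close>.\<close>

definition walk_positions ::
    "('a::euclidean_space \<times> real) set \<Rightarrow> ('a \<times> real) set \<Rightarrow> real \<Rightarrow> 'a set" where
  "walk_positions S I t =
     {fst ((next_point S ^^ n) s) | s n.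
        s \<in> I \<and> snd ((next_point S ^^ n) s) \<le> t \<and> t < snd ((next_point S ^^ Suc n) s)}"

definition process_from ::
    "'a::euclidean_space set \<Rightarrow> real \<Rightarrow> ('a \<times> real) set \<Rightarrow> 'a set" where
  "process_from \<eta> t S = walk_positions S ({s \<in> S. 0 \<le> snd s \<and> snd s \<le> t} \<union> \<eta> \<times> {0}) t"

definition stationary_config :: "('a::euclidean_space \<times> real) set \<Rightarrow> 'a set" where
  "stationary_config S = walk_positions S {s \<in> S. snd s \<le> 0} 0"

text \<open>Both configurations are well defined and locally finite only almost surely. Expectations are
  therefore taken with respect to the completion of \<open>N\<close>, so that exceptional null sets
  cannot affect the measurability of the integrands.\<close>

definition transition_semigroup ::
    "('a::euclidean_space \<times> real) set measure \<Rightarrow> real \<Rightarrow> ('a set \<Rightarrow> real) \<Rightarrow> 'a set \<Rightarrow> real" where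
  "transition_semigroup N t f \<eta> = (\<integral>S. f (process_from \<eta> t S) \<partial>completion N)"

text \<open>The expectation under the unique invariant measure, which is the law of \<open>stationary_config\<close>.\<close>

definition stationary_expectation ::
    "('a::euclidean_space \<times> real) set measure \<Rightarrow> ('a set \<Rightarrow> real) \<Rightarrow> real" where
  "stationary_expectation N f = (\<integral>S. f (stationary_config S) \<partial>completion N)"

definition finite_support :: "('a::euclidean_space set \<Rightarrow> real) \<Rightarrow> bool" where
  "finite_support f \<longleftrightarrow> (\<exists>\<Lambda>. bounded \<Lambda> \<and> (\<forall>\<eta>\<in>configurations. f \<eta> = f (\<eta> \<inter> \<Lambda>)))"

text \<open>The supremum norm is extended-real valued, so that it is meaningful without a boundedness
  assumption.\<close>

definition sup_norm :: "('a::euclidean_space set \<Rightarrow> real) \<Rightarrow> ereal" where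
  "sup_norm g = (SUP \<eta>\<in>configurations. ereal \<bar>g \<eta>\<bar>)"

end

theory Submission
  imports Defs
begin

text \<open>
  Almost surely, the positions occupied at time \<open>t\<close> can be read off the Poisson points without
  following any walk: a starting point \<open>(x, r)\<close> with \<open>r \<le> t\<close> contributes the position \<open>x\<close> exactly when no
  Poisson point with time in \<open>(r, t]\<close> lies within distance \<open>1\<close> of \<open>x\<close>. Indeed every Poisson point that a
  walk visits up to time \<open>t\<close> is itself a starting point, so longer walks bring in nothing new. Both the process
  started from \<open>\<eta>\<close> and the stationary configuration are therefore sets of \<open>survivors\<close> of the
  same kind (\<open>process_from_eq_survivors\<close>, \<open>stationary_config_eq_survivors\<close>).

  This gives the mixing at once. Cover the bounded support \<open>\<Lambda>\<close> of \<open>f\<close> by finitely many balls of radius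
  \<open>1/2\<close>. If each ball contains a Poisson point with time in \<open>(a, t]\<close>, then everything in \<open>\<Lambda>\<close> from before
  time \<open>a\<close> has been absorbed, two points of one ball being at distance at most \<open>1\<close>, and what is seen
  in \<open>\<Lambda>\<close> at time \<open>t\<close> depends on the points after \<open>a\<close> only (\<open>survivors_covered_cong\<close>). With \<open>v\<close> the volume
  of a ball of radius \<open>1/2\<close>, a given ball receives no point during a time span \<open>t\<close> with probability
  \<open>exp (- l v t)\<close>. So \<open>P\<^sub>t f \<eta>\<close> differs by at most a constant times \<open>exp (- l v t)\<close> from the mean of
  \<open>f\<close> over the survivors at time \<open>t\<close> of the points with times in \<open>[0, t]\<close>, and the stationary mean
  differs as little from the mean over the survivors at time \<open>0\<close> of the points with times in
  \<open>[-t, 0]\<close>. Those two means agree because the Poisson law is invariant under time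
  translation (\<open>distr_translate\<close>). The rate is thus \<open>C = v\<close>.

  Two measure-theoretic points need an argument. The survivors must form a measurable
  function of the Poisson configuration (\<open>survivors_measurable\<close>); this comes from viewing normalised
  counting measures as a subprobability kernel. And translation invariance must be extracted from
  the Poisson distributions of single counts together with independence over disjoint sets, by
  splitting a finite family of sets into its atoms (\<open>prob_cards_cong\<close>).
\<close>

section \<open>The measurable space of locally finite configurations\<close>

lemma finite_configuration_Int: "S \<in> configurations \<Longrightarrow> bounded A \<Longrightarrow> finite (S \<inter> A)"
  by (auto simp: configurations_def)

lemma configurations_Un: "S \<in> configurations \<Longrightarrow> T \<in> configurations \<Longrightarrow> S \<union> T \<in> configurations"
  by (auto simp: configurations_def Int_Un_distrib2)

lemma configurations_time_slice:
  assumes "\<eta> \<in> configurations"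
  shows "\<eta> \<times> {r::real} \<in> configurations"
  unfolding configurations_def
proof safe
  fix \<Lambda> :: "('a \<times> real) set" assume "bounded \<Lambda>"
  then have "bounded (fst ` \<Lambda>)"
    by (rule bounded_linear_image) (rule bounded_linear_fst)
  with assms have "finite ((\<eta> \<inter> fst ` \<Lambda>) \<times> {r})"
    by (auto intro!: finite_cartesian_product finite_configuration_Int)
  then show "finite (\<eta> \<times> {r} \<inter> \<Lambda>)"
    by (rule finite_subset[rotated]) (auto simp: rev_image_eqI)
qed

lemma space_config_space [simp]: "space config_space = configurations"
  by (simp add: config_space_def space_measure_of_conv)

lemma sets_config_space: "sets config_space = sigma_sets configurations
     {{\<eta> \<in> configurations. card (\<eta> \<inter> A) = k} | A k. A \<in> sets borel \<and> bounded A}"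
  unfolding config_space_def by (rule sets_measure_of) auto

lemma measurable_card_Int:
  assumes "A \<in> sets borel" "bounded A"
  shows "(\<lambda>S. card (S \<inter> A)) \<in> config_space \<rightarrow>\<^sub>M count_space UNIV"
proof -
  have "(\<lambda>S. card (S \<inter> A)) -` {k} \<inter> configurations \<in> sets config_space" for k
    unfolding sets_config_space using assms by (intro sigma_sets.Basic) blast
  then show ?thesis
    by (simp add: measurable_count_space_eq2_countable)
qed

lemma measurable_config_spaceI:
  fixes g :: "'x \<Rightarrow> 'b::euclidean_space set"
  assumes "\<And>x. x \<in> space M \<Longrightarrow> g x \<in> configurations"
    and "\<And>A. A \<in> sets borel \<Longrightarrow> bounded A \<Longrightarrow> (\<lambda>x. card (g x \<inter> A)) \<in> M \<rightarrow>\<^sub>M count_space UNIV"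
  shows "g \<in> M \<rightarrow>\<^sub>M config_space"
  unfolding config_space_def
proof (rule measurable_measure_of)
  show "g \<in> space M \<rightarrow> configurations" using assms(1) by blast
  fix Y :: "'b set set"
  assume "Y \<in> {{\<eta> \<in> configurations. card (\<eta> \<inter> A) = k} | A k. A \<in> sets borel \<and> bounded A}"
  then obtain A k where Y: "Y = {\<eta> \<in> configurations. card (\<eta> \<inter> A) = k}"
    and A: "A \<in> sets borel" "bounded A" by blast
  have "g -` Y \<inter> space M = (\<lambda>x. card (g x \<inter> A)) -` {k} \<inter> space M"
    using assms(1) by (auto simp: Y)
  also have "\<dots> \<in> sets M"
    using assms(2)[OF A] by (rule measurable_sets) simp
  finally show "g -` Y \<inter> space M \<in> sets M" .
qed auto

section \<open>Measurability of thinned configurations\<close>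

text \<open>The uniform distribution on the points of \<open>S\<close> in \<open>B\<close>, and the null measure if there are none (the
  scaling factor is then infinite, but the counting measure vanishes). The normalisation makes it a
  subprobability, so that the measurability theory of the Giry monad applies.\<close>

definition counting_kernel :: "'b set \<Rightarrow> 'b set \<Rightarrow> 'b::euclidean_space measure" where
  "counting_kernel B S = scale_measure (inverse (of_nat (card (S \<inter> B))))
     (distr (count_space (S \<inter> B)) borel (\<lambda>x. x))"

lemma sets_counting_kernel [simp]: "sets (counting_kernel B S) = sets borel"
  by (simp add: counting_kernel_def)

lemma emeasure_counting_kernel:
  assumes "S \<in> configurations" "bounded B" "A \<in> sets borel"
  shows "emeasure (counting_kernel B S) A
    = inverse (of_nat (card (S \<inter> B))) * of_nat (card (S \<inter> (B \<inter> A)))"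
proof -
  have "finite (S \<inter> B)" using assms finite_configuration_Int by blast
  moreover have "A \<inter> (S \<inter> B) = S \<inter> (B \<inter> A)" "S \<inter> (B \<inter> A) \<subseteq> S \<inter> B" by blast+
  ultimately show ?thesis
    using assms(3) finite_subset[of "S \<inter> (B \<inter> A)" "S \<inter> B"]
    by (simp add: counting_kernel_def emeasure_distr emeasure_count_space)
qed

lemma counting_kernel_measurable:
  assumes B: "B \<in> sets borel" "bounded B"
  shows "counting_kernel B \<in> config_space \<rightarrow>\<^sub>M subprob_algebra borel"
proof (rule measurable_subprob_algebra)
  fix S :: "'a set" assume "S \<in> space config_space"
  then have S: "S \<in> configurations" by simp
  show "subprob_space (counting_kernel B S)"
  proof
    have sp: "space (counting_kernel B S) = UNIV"
      by (rule sets_eq_imp_space_eq[of _ borel, simplified]) simp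
    have "inverse (of_nat n) * of_nat n \<le> (1::ennreal)" for n :: nat
      by (cases "n = 0") (auto simp: ennreal_of_nat_eq_real_of_nat inverse_ennreal ennreal_mult[symmetric])
    then show "emeasure (counting_kernel B S) (space (counting_kernel B S)) \<le> 1"
      using S B by (simp add: sp emeasure_counting_kernel)
    show "space (counting_kernel B S) \<noteq> {}" by (simp add: sp)
  qed
next
  fix A :: "'a set" assume A: "A \<in> sets borel"
  have *: "(\<lambda>S. card (S \<inter> B)) \<in> config_space \<rightarrow>\<^sub>M count_space UNIV"
    "(\<lambda>S. card (S \<inter> (B \<inter> A))) \<in> config_space \<rightarrow>\<^sub>M count_space UNIV"
    using A B by (auto intro!: measurable_card_Int bounded_Int)
  have "(\<lambda>S. inverse (of_nat (card (S \<inter> B))) * of_nat (card (S \<inter> (B \<inter> A))) :: ennreal)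
      \<in> borel_measurable config_space"
    using *[THEN measurable_compose, of "\<lambda>n. of_nat n :: ennreal"] by measurable
  then show "(\<lambda>S. emeasure (counting_kernel B S) A) \<in> borel_measurable config_space"
    using A B by (subst measurable_cong[OF emeasure_counting_kernel]) auto
qed simp

text \<open>The condition on \<open>p\<close> says that \<open>{q. R p q}\<close> is null for the counting kernel on \<open>B'\<close>, which is
  jointly measurable in \<open>p\<close> and \<open>S\<close>; integrating it against the counting kernel on \<open>B\<close> and multiplying
  by the number of points in \<open>B\<close> recovers the count.\<close>

lemma measurable_card_thinned:
  assumes B: "B \<in> sets borel" "bounded B" and B': "B' \<in> sets borel" "bounded B'"
    and R: "{(p, q). R p q} \<in> sets (borel \<Otimes>\<^sub>M borel)"
  shows "(\<lambda>S. card {p \<in> S \<inter> B. \<forall>q\<in>S \<inter> B'. \<not> R p q}) \<in> config_space \<rightarrow>\<^sub>M count_space UNIV"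
proof -
  define isolated where "isolated S = {p. emeasure (counting_kernel B' S) {q. R p q} = 0}" for S
  have R_section: "{q. R p q} \<in> sets borel" for p
    using sets_Pair1[OF R, of p] by (simp add: vimage_def)
  have isolated_iff: "p \<in> isolated S \<longleftrightarrow> (\<forall>q\<in>S \<inter> B'. \<not> R p q)" if "S \<in> configurations" for p S
  proof -
    have "finite (S \<inter> B')" "finite (S \<inter> (B' \<inter> {q. R p q}))"
      using that B' by (simp_all add: finite_configuration_Int bounded_Int)
    then show ?thesis
      using that B' R_section[of p] by (auto simp: isolated_def emeasure_counting_kernel)
  qed
  have *: "(\<lambda>x. emeasure (counting_kernel B' (fst x)) {q. R (snd x) q})
      \<in> borel_measurable (config_space \<Otimes>\<^sub>M borel)"
  proof (rule emeasure_measurable_subprob_algebra2)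
    have 1: "(\<lambda>x. (snd (fst x), snd x)) \<in> (config_space \<Otimes>\<^sub>M borel) \<Otimes>\<^sub>M borel \<rightarrow>\<^sub>M borel \<Otimes>\<^sub>M borel"
      by measurable
    show "Sigma (space (config_space \<Otimes>\<^sub>M borel)) (\<lambda>x. {q. R (snd x) q})
        \<in> sets ((config_space \<Otimes>\<^sub>M borel) \<Otimes>\<^sub>M borel)"
      using measurable_sets[OF 1 R] by (rule back_subst[where P="\<lambda>x. x \<in> _"]) (auto simp: space_pair_measure)
    show "(\<lambda>x. counting_kernel B' (fst x)) \<in> config_space \<Otimes>\<^sub>M borel \<rightarrow>\<^sub>M subprob_algebra borel"
      using measurable_compose[OF measurable_fst counting_kernel_measurable[OF B']] .
  qed
  have iso: "Sigma (space config_space) isolated \<in> sets (config_space \<Otimes>\<^sub>M borel)"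
    using measurable_sets[OF *, of "{0}"]
    by (rule back_subst[where P="\<lambda>x. x \<in> _"]) (auto simp: space_pair_measure isolated_def)
  have "isolated S \<in> sets borel" if "S \<in> configurations" for S
    using sets_Pair1[OF iso, of S] that by (simp add: vimage_def)
  then have card_eq: "of_nat (card {p \<in> S \<inter> B. \<forall>q\<in>S \<inter> B'. \<not> R p q})
      = of_nat (card (S \<inter> B)) * emeasure (counting_kernel B S) (isolated S)"
    if "S \<in> configurations" for S
  proof -
    have fin: "finite (S \<inter> B)" "finite (S \<inter> (B \<inter> isolated S))"
      using that B by (simp_all add: finite_configuration_Int bounded_Int)
    have "of_nat (card (S \<inter> B)) * emeasure (counting_kernel B S) (isolated S)
        = of_nat (card (S \<inter> (B \<inter> isolated S)))"
    proof (cases "card (S \<inter> B) = 0")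
      case True
      then have "S \<inter> B = {}" using fin by simp
      then have "S \<inter> (B \<inter> isolated S) = {}" by blast
      then show ?thesis using True by simp
    next
      case False
      then have "of_nat (card (S \<inter> B)) * inverse (of_nat (card (S \<inter> B))) = (1::ennreal)"
        by (simp add: ennreal_of_nat_eq_real_of_nat inverse_ennreal ennreal_mult[symmetric])
      then show ?thesis
        using that B \<open>\<And>S. S \<in> configurations \<Longrightarrow> isolated S \<in> sets borel\<close>
        by (simp add: emeasure_counting_kernel mult.assoc[symmetric])
    qed
    moreover have "S \<inter> (B \<inter> isolated S) = {p \<in> S \<inter> B. \<forall>q\<in>S \<inter> B'. \<not> R p q}"
      using isolated_iff[OF that] by blast
    ultimately show ?thesis by simp
  qed
  have meas: "(\<lambda>S. of_nat (card (S \<inter> B)) * emeasure (counting_kernel B S) (isolated S))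
      \<in> borel_measurable config_space"
    using emeasure_measurable_subprob_algebra2[OF iso counting_kernel_measurable[OF B]]
      measurable_compose[OF measurable_card_Int[OF B], of "\<lambda>n. of_nat n :: ennreal"]
    by measurable
  have "(\<lambda>S. card {p \<in> S \<inter> B. \<forall>q\<in>S \<inter> B'. \<not> R p q}) -` {k} \<inter> configurations \<in> sets config_space" for k
  proof -
    have "(\<lambda>S. card {p \<in> S \<inter> B. \<forall>q\<in>S \<inter> B'. \<not> R p q}) -` {k} \<inter> configurations
      = (\<lambda>S. of_nat (card (S \<inter> B)) * emeasure (counting_kernel B S) (isolated S))
          -` {of_nat k :: ennreal} \<inter> space config_space"
      using card_eq by (auto simp flip: card_eq)
    then show ?thesis using measurable_sets[OF meas, of "{of_nat k}"] by simp
  qed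
  then show ?thesis by (simp add: measurable_count_space_eq2_countable)
qed

section \<open>Survivors\<close>

text \<open>By time \<open>t\<close> a walker that has been at the space-time point \<open>p\<close> has been forced to move on by
  the Poisson point \<open>q\<close> or by an earlier one.\<close>

definition absorbs :: "real \<Rightarrow> 'a::euclidean_space \<times> real \<Rightarrow> 'a \<times> real \<Rightarrow> bool" where
  "absorbs t q p \<longleftrightarrow> norm (fst p - fst q) \<le> 1 \<and> snd p < snd q \<and> snd q \<le> t"

definition unabsorbed :: "real \<Rightarrow> real \<Rightarrow> ('a::euclidean_space \<times> real) set \<Rightarrow> ('a \<times> real) set" where
  "unabsorbed a t S = {p \<in> S. a \<le> snd p \<and> snd p \<le> t \<and> (\<forall>q\<in>S. \<not> absorbs t q p)}"

definition survivors :: "real \<Rightarrow> real \<Rightarrow> ('a::euclidean_space \<times> real) set \<Rightarrow> 'a set" where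
  "survivors a t S = fst ` unabsorbed a t S"

text \<open>Only points in a bounded region of space-time decide what survives inside a bounded set, because
  absorption has range \<open>1\<close>.\<close>

lemma unabsorbed_window:
  assumes "A \<subseteq> cball 0 e"
  shows "{p \<in> unabsorbed a t S. fst p \<in> A} = {p \<in> S \<inter> A \<times> {a..t}.
    \<forall>q\<in>S \<inter> cball 0 (e + 1) \<times> {a..t}. \<not> absorbs t q p}"
proof -
  have "q \<in> cball 0 (e + 1) \<times> {a..t}" if "absorbs t q p" "fst p \<in> A" "a \<le> snd p" for p q
  proof -
    have "norm (fst q) \<le> norm (fst p) + norm (fst p - fst q)" by norm
    moreover have "norm (fst p) \<le> e" using that assms by (auto simp: subset_iff)
    ultimately show ?thesis using that by (cases q) (auto simp: absorbs_def)
  qed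
  then show ?thesis
    unfolding unabsorbed_def by (auto simp: mem_Times_iff)
qed

lemma survivors_Int: "survivors a t S \<inter> A = fst ` {p \<in> unabsorbed a t S. fst p \<in> A}"
  by (auto simp: survivors_def)

text \<open>Of two points above the same location the later one absorbs the earlier. Hence counting
  survivors amounts to counting unabsorbed points.\<close>

lemma inj_on_unabsorbed: "inj_on fst (unabsorbed a t S)"
proof (rule inj_onI)
  fix p q :: "'a \<times> real" assume *: "p \<in> unabsorbed a t S" "q \<in> unabsorbed a t S" "fst p = fst q"
  then have "\<not> snd p < snd q" "\<not> snd q < snd p"
    by (auto simp: unabsorbed_def absorbs_def)
  with * show "p = q" by (simp add: prod_eq_iff)
qed

lemma survivors_configurations:
  assumes "S \<in> configurations"
  shows "survivors a t S \<in> configurations"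
  unfolding configurations_def
proof safe
  fix \<Lambda> :: "'a set" assume "bounded \<Lambda>"
  then obtain e where "\<Lambda> \<subseteq> cball 0 e"
    using bounded_subset_ballD[of _ 0] ball_subset_cball[of 0] by (meson subset_trans)
  moreover have "finite (S \<inter> \<Lambda> \<times> {a..t})"
    using assms \<open>bounded \<Lambda>\<close> by (intro finite_configuration_Int bounded_Times) auto
  ultimately show "finite (survivors a t S \<inter> \<Lambda>)"
    unfolding survivors_Int
    by (intro finite_imageI, subst unabsorbed_window) (auto elim: finite_subset[rotated])
qed

lemma survivors_measurable: "survivors a t \<in> config_space \<rightarrow>\<^sub>M config_space"
proof (rule measurable_config_spaceI)
  show "survivors a t S \<in> configurations" if "S \<in> space config_space" for S
    using that survivors_configurations by simp
next
  fix A :: "'a set" assume A: "A \<in> sets borel" "bounded A"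
  then obtain e where e: "A \<subseteq> cball 0 e"
    using bounded_subset_ballD[of _ 0] ball_subset_cball[of 0] by (meson subset_trans)
  have fst_snd [measurable]: "(fst :: 'a \<times> real \<Rightarrow> 'a) \<in> borel_measurable borel"
    "(snd :: 'a \<times> real \<Rightarrow> real) \<in> borel_measurable borel"
    by (auto intro!: borel_measurable_continuous_onI continuous_intros)
  have "{x \<in> space (borel \<Otimes>\<^sub>M borel). absorbs t (snd x) (fst x)}
      \<in> sets (borel \<Otimes>\<^sub>M (borel :: ('a \<times> real) measure))"
    unfolding absorbs_def by measurable
  also have "{x \<in> space (borel \<Otimes>\<^sub>M borel). absorbs t (snd x) (fst x)} = {(p, q). absorbs t q p}"
    by (auto simp: space_pair_measure)
  finally have R: "{(p, q). absorbs t q p} \<in> sets (borel \<Otimes>\<^sub>M (borel :: ('a \<times> real) measure))" .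
  have "card (survivors a t S \<inter> A) = card {p \<in> S \<inter> A \<times> {a..t}.
      \<forall>q\<in>S \<inter> cball 0 (e + 1) \<times> {a..t}. \<not> absorbs t q p}" for S
    unfolding survivors_Int unabsorbed_window[OF e, symmetric]
    by (intro card_image inj_on_subset[OF inj_on_unabsorbed]) auto
  moreover have "(\<lambda>S. card {p \<in> S \<inter> A \<times> {a..t}.
      \<forall>q\<in>S \<inter> cball 0 (e + 1) \<times> {a..t}. \<not> absorbs t q p}) \<in> config_space \<rightarrow>\<^sub>M count_space UNIV"
    using A by (intro measurable_card_thinned[OF _ _ _ _ R]) (auto intro!: bounded_Times borel_Times)
  ultimately show "(\<lambda>S. card (survivors a t S \<inter> A)) \<in> config_space \<rightarrow>\<^sub>M count_space UNIV"
    by simp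
qed

text \<open>Used with the initial configuration placed at time \<open>0\<close>. A point of \<open>T\<close> that happens to be in \<open>S\<close> must be
  counted once, which is why the finite set \<open>T \<inter> A\<close> is removed from \<open>A\<close>.\<close>

lemma measurable_Un_configuration:
  assumes "T \<in> configurations"
  shows "(\<lambda>S. S \<union> T) \<in> config_space \<rightarrow>\<^sub>M config_space"
proof (rule measurable_config_spaceI)
  show "S \<union> T \<in> configurations" if "S \<in> space config_space" for S
    using that assms configurations_Un by simp
next
  fix A :: "'a set" assume A: "A \<in> sets borel" "bounded A"
  have fin: "finite (T \<inter> A)" using assms A finite_configuration_Int by blast
  have "card ((S \<union> T) \<inter> A) = card (S \<inter> (A - T \<inter> A)) + card (T \<inter> A)"
    if "S \<in> configurations" for S
  proof -
    have "(S \<union> T) \<inter> A = (S \<inter> (A - T \<inter> A)) \<union> (T \<inter> A)" by blast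
    moreover have "finite (S \<inter> (A - T \<inter> A))"
      using that A by (intro finite_configuration_Int bounded_diff)
    ultimately show ?thesis using fin by (simp add: card_Un_disjoint Int_commute disjoint_iff)
  qed
  moreover have "(\<lambda>S. card (S \<inter> (A - T \<inter> A)) + card (T \<inter> A)) \<in> config_space \<rightarrow>\<^sub>M count_space UNIV"
  proof -
    have "A - T \<inter> A \<in> sets borel" using sets.Diff[OF A(1) borel_closed[OF finite_imp_closed[OF fin]]] .
    then show ?thesis
      using measurable_compose[OF measurable_card_Int, of "A - T \<inter> A" "\<lambda>n. n + card (T \<inter> A)"] A
      by (simp add: bounded_diff)
  qed
  ultimately show "(\<lambda>S. card ((S \<union> T) \<inter> A)) \<in> config_space \<rightarrow>\<^sub>M count_space UNIV"
    by (subst measurable_cong[where g="\<lambda>S. card (S \<inter> (A - T \<inter> A)) + card (T \<inter> A)"]) auto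
qed

section \<open>Walks and survivors\<close>

text \<open>Local finiteness turns the choice of a point with minimal time into a genuine minimum.\<close>

lemma next_point_minimal:
  assumes S: "S \<in> configurations"
    and ex: "\<exists>q\<in>S. norm (fst s - fst q) \<le> 1 \<and> snd s < snd q"
  shows "next_point S s \<in> S" "norm (fst s - fst (next_point S s)) \<le> 1" "snd s < snd (next_point S s)"
    and "\<And>q. q \<in> S \<Longrightarrow> norm (fst s - fst q) \<le> 1 \<Longrightarrow> snd s < snd q \<Longrightarrow> snd (next_point S s) \<le> snd q"
proof -
  define P where "P q \<longleftrightarrow> q \<in> S \<and> norm (fst s - fst q) \<le> 1 \<and> snd s < snd q" for q
  obtain q0 where q0: "P q0" using ex P_def by blast
  let ?Q = "{q. P q \<and> snd q \<le> snd q0}"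
  have "?Q \<subseteq> S \<inter> cball (fst s) 1 \<times> {snd s..snd q0}"
    by (auto simp: P_def dist_norm mem_Times_iff)
  moreover have "finite (S \<inter> cball (fst s) 1 \<times> {snd s..snd q0})"
    using S by (intro finite_configuration_Int bounded_Times) auto
  ultimately have "finite ?Q" by (rule finite_subset)
  moreover have "?Q \<noteq> {}" using q0 by blast
  ultimately obtain m where m: "is_arg_min snd (\<lambda>q. q \<in> ?Q) m"
    using ex_is_arg_min_if_finite by blast
  have "P (next_point S s) \<and> (\<forall>q. P q \<longrightarrow> snd (next_point S s) \<le> snd q)"
    unfolding next_point_def P_def[symmetric]
  proof (rule arg_minI)
    show "P m" using m by (simp add: is_arg_min_def)
    show "\<not> snd q < snd m" if "P q" for q
    proof
      assume "snd q < snd m"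
      moreover have "snd m \<le> snd q0" using m by (simp add: is_arg_min_def)
      ultimately have "q \<in> ?Q" using that by simp
      with m \<open>snd q < snd m\<close> show False unfolding is_arg_min_def by blast
    qed
    show "P x \<and> (\<forall>q. P q \<longrightarrow> snd x \<le> snd q)" if "P x" "\<forall>y. P y \<longrightarrow> \<not> snd y < snd x" for x
      using that by (auto simp: not_less)
  qed
  then show "next_point S s \<in> S" "norm (fst s - fst (next_point S s)) \<le> 1" "snd s < snd (next_point S s)"
    and "\<And>q. q \<in> S \<Longrightarrow> norm (fst s - fst q) \<le> 1 \<Longrightarrow> snd s < snd q \<Longrightarrow> snd (next_point S s) \<le> snd q"
    by (auto simp: P_def)
qed

text \<open>The condition under which all walks are defined for all times; it holds almost surely.\<close>

definition unbounded_future :: "('a::euclidean_space \<times> real) set \<Rightarrow> bool" where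
  "unbounded_future S \<longleftrightarrow> (\<forall>x r. \<exists>q\<in>S. norm (x - fst q) \<le> 1 \<and> r < snd q)"

lemma next_point_after_iff:
  assumes "S \<in> configurations" "unbounded_future S"
  shows "t < snd (next_point S s) \<longleftrightarrow> (\<forall>q\<in>S. \<not> absorbs t q s)"
proof -
  have "\<exists>q\<in>S. norm (fst s - fst q) \<le> 1 \<and> snd s < snd q"
    using assms(2) by (auto simp: unbounded_future_def)
  note next_point_minimal[OF assms(1) this]
  then show ?thesis
    unfolding absorbs_def by (meson leD not_le_imp_less order.trans)
qed

text \<open>If the set of starting points contains the steps up to time \<open>t\<close> of its walks, then the point at which a walk sits at time
  \<open>t\<close> is itself a starting point, so walks of length \<open>0\<close> already give all positions.\<close>

lemma walk_positions_eq:
  assumes S: "S \<in> configurations" "unbounded_future S"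
    and closed: "\<And>s. s \<in> I \<Longrightarrow> snd (next_point S s) \<le> t \<Longrightarrow> next_point S s \<in> I"
  shows "walk_positions S I t = fst ` {s \<in> I. snd s \<le> t \<and> (\<forall>q\<in>S. \<not> absorbs t q s)}"
proof -
  have up: "snd s < snd (next_point S s)" for s
    using S(2) by (intro next_point_minimal[OF S(1)]) (auto simp: unbounded_future_def)
  have iter: "(next_point S ^^ n) s \<in> I" if "s \<in> I" "snd ((next_point S ^^ n) s) \<le> t" for s n
    using that(2)
  proof (induction n)
    case (Suc n)
    then have "snd ((next_point S ^^ n) s) \<le> t"
      using up[of "(next_point S ^^ n) s"] by simp
    with Suc show ?case using closed by simp
  qed (use that in simp)
  have "walk_positions S I t = fst ` {s \<in> I. snd s \<le> t \<and> t < snd (next_point S s)}"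
  proof
    show "walk_positions S I t \<subseteq> fst ` {s \<in> I. snd s \<le> t \<and> t < snd (next_point S s)}"
      unfolding walk_positions_def using iter by auto
    show "fst ` {s \<in> I. snd s \<le> t \<and> t < snd (next_point S s)} \<subseteq> walk_positions S I t"
    proof (rule image_subsetI)
      fix s assume "s \<in> {s \<in> I. snd s \<le> t \<and> t < snd (next_point S s)}"
      then show "fst s \<in> walk_positions S I t"
        unfolding walk_positions_def mem_Collect_eq by (intro exI[of _ s] exI[of _ "0::nat"]) simp
    qed
  qed
  then show ?thesis by (simp add: next_point_after_iff[OF S])
qed

lemma process_from_eq_survivors:
  assumes S: "S \<in> configurations" "unbounded_future S" and "0 \<le> t"
  shows "process_from \<eta> t S = survivors 0 t (S \<union> \<eta> \<times> {0})"
proof -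
  let ?I = "{s \<in> S. 0 \<le> snd s \<and> snd s \<le> t} \<union> \<eta> \<times> {0}"
  have "next_point S s \<in> ?I" if "s \<in> ?I" "snd (next_point S s) \<le> t" for s
  proof -
    have "\<exists>q\<in>S. norm (fst s - fst q) \<le> 1 \<and> snd s < snd q"
      using S(2) by (auto simp: unbounded_future_def)
    note next_point_minimal(1,3)[OF S(1) this]
    moreover have "0 \<le> snd s" using that(1) by auto
    ultimately show ?thesis using that(2) by auto
  qed
  note walk_positions_eq[OF S this]
  moreover have "{s \<in> ?I. snd s \<le> t \<and> (\<forall>q\<in>S. \<not> absorbs t q s)} = unabsorbed 0 t (S \<union> \<eta> \<times> {0})"
    using \<open>0 \<le> t\<close> unfolding unabsorbed_def absorbs_def by auto
  ultimately show ?thesis by (simp add: process_from_def survivors_def)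
qed

text \<open>The union over starting times reduces the infinite past to configurations for which measurability is
  known.\<close>

lemma stationary_config_eq_survivors:
  assumes S: "S \<in> configurations" "unbounded_future S"
  shows "stationary_config S = (\<Union>n. survivors (- real n) 0 S)"
proof -
  have "next_point S s \<in> S" for s
    using S(2) by (intro next_point_minimal(1)[OF S(1)]) (auto simp: unbounded_future_def)
  then have "stationary_config S
      = fst ` {s \<in> {s \<in> S. snd s \<le> 0}. snd s \<le> 0 \<and> (\<forall>q\<in>S. \<not> absorbs 0 q s)}"
    unfolding stationary_config_def by (intro walk_positions_eq[OF S]) auto
  also have "{s \<in> {s \<in> S. snd s \<le> 0}. snd s \<le> 0 \<and> (\<forall>q\<in>S. \<not> absorbs 0 q s)}
      = (\<Union>n. unabsorbed (- real n) 0 S)"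
  proof -
    have "\<exists>n. - real n \<le> r" for r using real_arch_simple[of "- r"] by (metis minus_le_iff)
    then show ?thesis by (auto simp: unabsorbed_def)
  qed
  finally show ?thesis by (simp add: survivors_def image_UN)
qed

lemma survivors_translate:
  "survivors (a + c) (t + c) ((+) (0, c) ` S) = survivors a t S"
proof -
  have "unabsorbed (a + c) (t + c) ((+) (0, c) ` S) = (+) (0, c) ` unabsorbed a t S"
    by (auto simp: unabsorbed_def absorbs_def intro!: image_eqI[rotated])
  then show ?thesis by (simp add: survivors_def image_image)
qed

section \<open>Loss of memory over covered windows\<close>

text \<open>Radius \<open>1/2\<close> makes any two points of the ball close enough for one to absorb the other. Times are open
  on the left so that a point in the cell is strictly later than \<open>a\<close>.\<close>

definition cell :: "'a::euclidean_space \<Rightarrow> real \<Rightarrow> real \<Rightarrow> ('a \<times> real) set" where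
  "cell c a b = ball c (1/2) \<times> {a<..b}"

definition covered :: "'a::euclidean_space set \<Rightarrow> real \<Rightarrow> real \<Rightarrow> ('a \<times> real) set \<Rightarrow> bool" where
  "covered F a b S \<longleftrightarrow> (\<forall>c\<in>F. S \<inter> cell c a b \<noteq> {})"

lemma covered_absorbs:
  assumes "covered F a t S" "fst p \<in> (\<Union>c\<in>F. ball c (1/2))" "snd p \<le> a"
  shows "\<exists>q\<in>S. absorbs t q p"
proof -
  obtain c q where c: "fst p \<in> ball c (1/2)" and q: "q \<in> S" "q \<in> cell c a t"
    using assms(1,2) unfolding covered_def by blast
  have "dist (fst p) (fst q) \<le> dist c (fst p) + dist c (fst q)"
    by (metis dist_commute dist_triangle)
  moreover have "dist c (fst p) < 1/2" "dist c (fst q) < 1/2"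
    using c q by (auto simp: cell_def)
  ultimately show ?thesis
    using q assms(3) by (intro bexI[of _ q]) (auto simp: absorbs_def cell_def dist_norm)
qed

text \<open>Everything up to time \<open>a\<close> has been absorbed in the window, and absorption of later points involves later points only.
  So neither the lower time limits nor the points up to time \<open>a\<close>, in particular an initial
  configuration, leave a trace in the window.\<close>

lemma survivors_covered_cong:
  assumes cov: "covered F a t S" and A: "A \<subseteq> (\<Union>c\<in>F. ball c (1/2))"
    and b: "b \<le> a" "b' \<le> a"
    and agree: "\<And>p. a < snd p \<Longrightarrow> p \<in> S' \<longleftrightarrow> p \<in> S"
  shows "survivors b t S \<inter> A = survivors b' t S' \<inter> A"
proof -
  \<comment> \<open>In this form the set mentions the points of time greater than \<open>a\<close> only.\<close>
  have recent: "{p \<in> unabsorbed b t T. fst p \<in> A}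
      = {p \<in> T. fst p \<in> A \<and> a < snd p \<and> snd p \<le> t \<and> (\<forall>q\<in>T. \<not> absorbs t q p)}"
    if "covered F a t T" "b \<le> a" for b T
  proof -
    have "a < snd p" if "p \<in> unabsorbed b t T" "fst p \<in> A" for p
      using covered_absorbs[OF \<open>covered F a t T\<close>, of p] that A
      by (force simp: unabsorbed_def not_less[symmetric])
    then show ?thesis using \<open>b \<le> a\<close> by (auto simp: unabsorbed_def)
  qed
  have "covered F a t S'"
    using cov agree by (fastforce simp: covered_def cell_def)
  moreover have "{p \<in> S. fst p \<in> A \<and> a < snd p \<and> snd p \<le> t \<and> (\<forall>q\<in>S. \<not> absorbs t q p)}
      = {p \<in> S'. fst p \<in> A \<and> a < snd p \<and> snd p \<le> t \<and> (\<forall>q\<in>S'. \<not> absorbs t q p)}"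
  proof -
    have "q \<in> S' \<longleftrightarrow> q \<in> S" if "absorbs t q p" "a < snd p" for p q
      using that agree by (auto simp: absorbs_def)
    then show ?thesis using agree by blast
  qed
  ultimately show ?thesis
    unfolding survivors_Int using recent[OF cov b(1)] recent[of S' b'] b by simp
qed

lemma stationary_config_Int:
  assumes S: "S \<in> configurations" "unbounded_future S"
    and cov: "covered F a 0 S" and A: "A \<subseteq> (\<Union>c\<in>F. ball c (1/2))" and b: "b \<le> a"
  shows "stationary_config S \<inter> A = survivors b 0 S \<inter> A"
proof -
  obtain m where m: "- real m \<le> a" using real_arch_simple[of "- a"] by (metis minus_le_iff)
  have "survivors (- real n) 0 S \<inter> A \<subseteq> survivors b 0 S \<inter> A" for n
  proof -
    \<comment> \<open>Starting times after \<open>a\<close> see fewer points, starting times before \<open>a\<close> all see the same ones.\<close>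
    have "survivors (- real n) 0 S \<inter> A \<subseteq> survivors (- real (max n m)) 0 S \<inter> A"
      by (fastforce simp: survivors_def unabsorbed_def)
    also have "\<dots> = survivors b 0 S \<inter> A"
      using m b by (intro survivors_covered_cong[OF cov A]) auto
    finally show ?thesis .
  qed
  moreover have "survivors b 0 S \<inter> A = survivors (- real m) 0 S \<inter> A"
    using m b by (intro survivors_covered_cong[OF cov A]) auto
  ultimately show ?thesis unfolding stationary_config_eq_survivors[OF S] by blast
qed

text \<open>A countable set of centres serves all bounded windows at once, so that almost sure statements about
  single cells combine.\<close>

lemma countable_half_ball_cover:
  obtains D :: "'a::euclidean_space set" where "countable D"
    and "\<And>\<Lambda>. bounded \<Lambda> \<Longrightarrow> \<exists>F. finite F \<and> F \<subseteq> D \<and> \<Lambda> \<subseteq> (\<Union>c\<in>F. ball c (1/2))"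
proof -
  obtain D :: "'a set" where D: "countable D" "\<And>X. open X \<Longrightarrow> X \<noteq> {} \<Longrightarrow> \<exists>d\<in>D. d \<in> X"
    using countable_dense_exists[where 'a='a] by blast
  have "\<exists>F. finite F \<and> F \<subseteq> D \<and> \<Lambda> \<subseteq> (\<Union>c\<in>F. ball c (1/2))" if "bounded \<Lambda>" for \<Lambda> :: "'a set"
  proof -
    have "compact (closure \<Lambda>)" using that by simp
    moreover have "open (ball c (1/2))" if "c \<in> D" for c by simp
    moreover have "closure \<Lambda> \<subseteq> (\<Union>c\<in>D. ball c (1/2))"
    proof
      fix x
      obtain d where "d \<in> D" "d \<in> ball x (1/2)" using D(2)[of "ball x (1/2)"] by auto
      then show "x \<in> (\<Union>c\<in>D. ball c (1/2))" by (auto simp: dist_commute)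
    qed
    ultimately obtain F where "F \<subseteq> D" "finite F" "closure \<Lambda> \<subseteq> (\<Union>c\<in>F. ball c (1/2))"
      by (rule compactE_image) 
    then show ?thesis using closure_subset[of \<Lambda>] by blast
  qed
  then show ?thesis using D(1) that by blast
qed

section \<open>Translation invariance of the Poisson law\<close>

text \<open>The points lying in exactly the members of the family indexed by \<open>J\<close>.\<close>

definition atom :: "'i set \<Rightarrow> ('i \<Rightarrow> 'b set) \<Rightarrow> 'i set \<Rightarrow> 'b set" where
  "atom I A J = {x. {i \<in> I. x \<in> A i} = J}"

lemma atom_borel_bounded:
  assumes "finite I" "\<And>i. i \<in> I \<Longrightarrow> A i \<in> sets borel" "\<And>i. i \<in> I \<Longrightarrow> bounded (A i)"
    and "J \<subseteq> I" "J \<noteq> {}"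
  shows "atom I A J \<in> sets borel" "bounded (atom I A J)"
proof -
  have "atom I A J = (\<Inter>i\<in>J. A i) - (\<Union>i\<in>I - J. A i)"
    using assms(4,5) by (auto simp: atom_def)
  moreover have "finite J" using assms finite_subset by blast
  ultimately show "atom I A J \<in> sets borel"
    using assms by (auto intro!: sets.Diff sets.finite_INT sets.finite_UN)
  obtain j where "j \<in> J" using assms(5) by blast
  then have "atom I A J \<subseteq> A j" "j \<in> I" using assms(4) by (auto simp: atom_def)
  then show "bounded (atom I A J)" using assms(3) bounded_subset by blast
qed

locale poisson_process = prob_space N for N :: "'b::euclidean_space set measure" +
  fixes l :: real
  assumes law: "poisson_law l N"
begin

lemma sets_N: "sets N = sets config_space"
  using law by (simp add: poisson_law_def)

lemma space_N [simp]: "space N = configurations"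
  using sets_eq_imp_space_eq[OF sets_N] by simp

lemma measurable_N: "N \<rightarrow>\<^sub>M M = config_space \<rightarrow>\<^sub>M M"
  by (rule measurable_cong_sets) (simp_all add: sets_N)

lemma prob_card:
  assumes "A \<in> sets borel" "bounded A"
  shows "prob {S \<in> configurations. card (S \<inter> A) = k}
    = exp (- (l * measure lborel A)) * (l * measure lborel A) ^ k / fact k"
  using law assms unfolding poisson_law_def by simp

lemma random_variable_card:
  assumes "A \<in> sets borel" "bounded A"
  shows "random_variable (count_space UNIV) (\<lambda>S. card (S \<inter> A))"
  using measurable_card_Int[OF assms] by (simp add: measurable_N)

lemma indep_cards:
  fixes A :: "nat \<Rightarrow> 'b set"
  assumes "finite I" "disjoint_family_on A I" "\<And>i. i \<in> I \<Longrightarrow> A i \<in> sets borel" "\<And>i. i \<in> I \<Longrightarrow> bounded (A i)"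
  shows "indep_vars (\<lambda>_. count_space UNIV) (\<lambda>i S. card (S \<inter> A i)) I"
  using law assms unfolding poisson_law_def by blast

lemma prob_void:
  assumes "A \<in> sets borel" "bounded A"
  shows "{S \<in> configurations. S \<inter> A = {}} \<in> events"
    and "prob {S \<in> configurations. S \<inter> A = {}} = exp (- (l * measure lborel A))"
proof -
  have eq: "{S \<in> configurations. S \<inter> A = {}} = {S \<in> configurations. card (S \<inter> A) = 0}"
    using finite_configuration_Int[OF _ assms(2)] by auto
  have "(\<lambda>S. card (S \<inter> A)) -` {0} \<inter> space N \<in> events"
    by (rule measurable_sets[OF random_variable_card[OF assms]]) simp
  then show "{S \<in> configurations. S \<inter> A = {}} \<in> events"
    unfolding eq by (simp add: vimage_def Int_def conj_commute)
  show "prob {S \<in> configurations. S \<inter> A = {}} = exp (- (l * measure lborel A))"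
    unfolding eq prob_card[OF assms] by simp
qed

lemma distr_card_cong:
  assumes "A \<in> sets borel" "bounded A" "B \<in> sets borel" "bounded B"
    and "measure lborel A = measure lborel B"
  shows "distr N (count_space UNIV) (\<lambda>S. card (S \<inter> A)) = distr N (count_space UNIV) (\<lambda>S. card (S \<inter> B))"
proof (rule measure_eqI_countable[where A=UNIV])
  have "emeasure (distr N (count_space UNIV) (\<lambda>S. card (S \<inter> C))) {k}
      = ennreal (exp (- (l * measure lborel C)) * (l * measure lborel C) ^ k / fact k)"
    if "C \<in> sets borel" "bounded C" for C k
  proof -
    have "(\<lambda>S. card (S \<inter> C)) -` {k} \<inter> space N = {S \<in> configurations. card (S \<inter> C) = k}" by auto
    then show ?thesis
      using prob_card[OF that, of k] random_variable_card[OF that]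
      by (simp add: emeasure_distr emeasure_eq_measure)
  qed
  then show "emeasure (distr N (count_space UNIV) (\<lambda>S. card (S \<inter> A))) {k}
      = emeasure (distr N (count_space UNIV) (\<lambda>S. card (S \<inter> B))) {k}" for k
    using assms by simp
qed auto

text \<open>The atoms are disjoint, so their counts are independent and their joint law is a product; the counts in the
  \<open>A i\<close> are sums over atoms. The bijection \<open>h\<close> numbers the nonempty index sets, because independence is
  given for families indexed by natural numbers; the empty one is left out since its atom is
  unbounded.\<close>

lemma prob_cards_eq_PiM:
  assumes I: "finite I" "I \<noteq> {}" and A: "\<And>i. i \<in> I \<Longrightarrow> A i \<in> sets borel" "\<And>i. i \<in> I \<Longrightarrow> bounded (A i)"
    and h: "bij_betw h {..<n::nat} (Pow I - {{}})"
  shows "prob {S \<in> configurations. \<forall>i\<in>I. card (S \<inter> A i) = k i}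
    = measure (PiM {..<n} (\<lambda>m. distr N (count_space UNIV) (\<lambda>S. card (S \<inter> atom I A (h m)))))
       {v \<in> {..<n} \<rightarrow>\<^sub>E UNIV. \<forall>i\<in>I. (\<Sum>m | m < n \<and> i \<in> h m. v m) = k i}"
    (is "prob ?E = measure ?M ?W")
proof -
  have hm: "h m \<subseteq> I" "h m \<noteq> {}" if "m < n" for m
    using h that unfolding bij_betw_def by blast+
  note atom = atom_borel_bounded[OF I(1) A hm]
  let ?X = "\<lambda>m S. card (S \<inter> atom I A (h m))"
  let ?X' = "\<lambda>S. \<lambda>m\<in>{..<n}. ?X m S"
  have "n \<noteq> 0"
  proof
    assume "n = 0"
    then have "Pow I - {{}} = {}" using h by (simp add: bij_betw_def)
    then show False using I(2) by blast
  qed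
  have "disjoint_family_on (\<lambda>m. atom I A (h m)) {..<n}"
    using h unfolding disjoint_family_on_def atom_def bij_betw_def inj_on_def by blast
  then have "indep_vars (\<lambda>_. count_space UNIV) ?X {..<n}"
    using atom by (intro indep_cards) auto
  then have distr: "distr N (PiM {..<n} (\<lambda>_. count_space UNIV)) ?X' = ?M"
    using \<open>n \<noteq> 0\<close> atom
    by (subst (asm) indep_vars_iff_distr_eq_PiM') (auto intro!: random_variable_card)
  \<comment> \<open>The atoms that make up \<open>A i\<close> are those whose index set contains \<open>i\<close>.\<close>
  have card_sum: "card (S \<inter> A i) = (\<Sum>m | m < n \<and> i \<in> h m. ?X m S)"
    if S: "S \<in> configurations" and i: "i \<in> I" for S i
  proof -
    have "S \<inter> A i = (\<Union>m\<in>{m. m < n \<and> i \<in> h m}. S \<inter> atom I A (h m))"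
    proof (intro equalityI subsetI)
      fix x assume x: "x \<in> S \<inter> A i"
      then have "{i \<in> I. x \<in> A i} \<in> Pow I - {{}}" using i by blast
      then obtain m where "m < n" "h m = {i \<in> I. x \<in> A i}"
        using h unfolding bij_betw_def by (metis (lifting) imageE lessThan_iff)
      then show "x \<in> (\<Union>m\<in>{m. m < n \<and> i \<in> h m}. S \<inter> atom I A (h m))"
        using x i by (auto simp: atom_def)
    qed (auto simp: atom_def)
    moreover have "card (\<Union>m\<in>{m. m < n \<and> i \<in> h m}. S \<inter> atom I A (h m)) = (\<Sum>m | m < n \<and> i \<in> h m. ?X m S)"
    proof (rule card_UN_disjoint)
      show "\<forall>m\<in>{m. m < n \<and> i \<in> h m}. finite (S \<inter> atom I A (h m))"
        using S atom(2) by (auto intro: finite_configuration_Int)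
      show "\<forall>m\<in>{m. m < n \<and> i \<in> h m}. \<forall>m'\<in>{m. m < n \<and> i \<in> h m}. m \<noteq> m' \<longrightarrow>
          S \<inter> atom I A (h m) \<inter> (S \<inter> atom I A (h m')) = {}"
        using h unfolding atom_def bij_betw_def inj_on_def by blast
    qed simp
    ultimately show ?thesis by simp
  qed
  \<comment> \<open>The product of finitely many countable discrete spaces is discrete.\<close>
  have W: "?W \<in> sets (PiM {..<n} (\<lambda>_. count_space UNIV))"
    by (subst count_space_PiM_finite) auto
  have X': "?X' \<in> N \<rightarrow>\<^sub>M PiM {..<n} (\<lambda>_. count_space UNIV)"
    using atom by (intro measurable_restrict random_variable_card) auto
  have "?E = ?X' -` ?W \<inter> space N"
    using card_sum by (auto intro!: sum.cong)
  then have "prob ?E = measure (distr N (PiM {..<n} (\<lambda>_. count_space UNIV)) ?X') ?W"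
    using W X' by (simp add: measure_distr)
  then show ?thesis unfolding distr .
qed

text \<open>Joint laws of counts depend on the sets only through the volumes of their atoms.\<close>

lemma prob_cards_cong:
  assumes I: "finite I"
    and A: "\<And>i. i \<in> I \<Longrightarrow> A i \<in> sets borel" "\<And>i. i \<in> I \<Longrightarrow> bounded (A i)"
    and B: "\<And>i. i \<in> I \<Longrightarrow> B i \<in> sets borel" "\<And>i. i \<in> I \<Longrightarrow> bounded (B i)"
    and eq: "\<And>J. J \<subseteq> I \<Longrightarrow> J \<noteq> {} \<Longrightarrow> measure lborel (atom I A J) = measure lborel (atom I B J)"
  shows "prob {S \<in> configurations. \<forall>i\<in>I. card (S \<inter> A i) = k i}
    = prob {S \<in> configurations. \<forall>i\<in>I. card (S \<inter> B i) = k i}"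
proof (cases "I = {}")
  case False
  obtain h :: "nat \<Rightarrow> _" and n where h: "bij_betw h {..<n} (Pow I - {{}})"
    using ex_bij_betw_nat_finite[of "Pow I - {{}}"] I by (auto simp: atLeast0LessThan)
  have hm: "h m \<subseteq> I" "h m \<noteq> {}" if "m < n" for m
    using h that unfolding bij_betw_def by blast+
  have "distr N (count_space UNIV) (\<lambda>S. card (S \<inter> atom I A (h m)))
      = distr N (count_space UNIV) (\<lambda>S. card (S \<inter> atom I B (h m)))" if "m < n" for m
    using atom_borel_bounded[OF I A hm[OF that]] atom_borel_bounded[OF I B hm[OF that]] eq[OF hm[OF that]]
    by (intro distr_card_cong) auto
  then have "PiM {..<n} (\<lambda>m. distr N (count_space UNIV) (\<lambda>S. card (S \<inter> atom I A (h m))))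
      = PiM {..<n} (\<lambda>m. distr N (count_space UNIV) (\<lambda>S. card (S \<inter> atom I B (h m))))"
    by (intro PiM_cong) auto
  then show ?thesis
    using prob_cards_eq_PiM[OF I False A h] prob_cards_eq_PiM[OF I False B h] by simp
qed simp

end

lemma translate_eq_vimage:
  fixes A :: "'b::ab_group_add set"
  shows "(+) c ` A = (+) (- c) -` A"
proof (intro equalityI subsetI)
  fix x assume "x \<in> (+) (- c) -` A"
  then show "x \<in> (+) c ` A" by (intro image_eqI[of _ _ "- c + x"]) auto
qed auto

lemma measure_lborel_translate:
  fixes A :: "'b::euclidean_space set"
  assumes "A \<in> sets borel"
  shows "measure lborel ((+) c ` A) = measure lborel A"
proof -
  have "measure lborel A = measure (distr lborel borel ((+) (- c))) A"
    by (simp only: lborel_distr_plus)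
  also have "\<dots> = measure lborel ((+) (- c) -` A)"
    using assms by (subst measure_distr) auto
  finally show ?thesis unfolding translate_eq_vimage by simp
qed

lemma card_translate_Int:
  fixes S :: "'b::ab_group_add set"
  shows "card ((+) c ` S \<inter> A) = card (S \<inter> (+) (- c) ` A)"
proof -
  have "(+) c ` S \<inter> A = (+) c ` (S \<inter> (+) (- c) ` A)"
    unfolding translate_eq_vimage[of "- c"] by auto
  then show ?thesis by (simp add: card_image)
qed

lemma borel_bounded_translate:
  fixes A :: "'b::euclidean_space set"
  assumes "A \<in> sets borel" "bounded A"
  shows "(+) c ` A \<in> sets borel" "bounded ((+) c ` A)"
proof -
  show "(+) c ` A \<in> sets borel"
    unfolding translate_eq_vimage using measurable_sets[of "(+) (- c)" borel borel A] assms(1) by simp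
  show "bounded ((+) c ` A)" using assms(2) by (rule bounded_translation)
qed

lemma translate_measurable:
  "(`) ((+) c) \<in> config_space \<rightarrow>\<^sub>M (config_space :: 'b::euclidean_space set measure)"
proof (rule measurable_config_spaceI)
  fix S :: "'b set" assume "S \<in> space config_space"
  then have S: "S \<in> configurations" by simp
  show "(+) c ` S \<in> configurations"
    unfolding configurations_def
  proof safe
    fix \<Lambda> :: "'b set" assume "bounded \<Lambda>"
    then have "finite ((+) c ` (S \<inter> (+) (- c) ` \<Lambda>))"
      using S by (intro finite_imageI finite_configuration_Int bounded_translation)
    moreover have "(+) c ` S \<inter> \<Lambda> = (+) c ` (S \<inter> (+) (- c) ` \<Lambda>)"
      unfolding translate_eq_vimage[of "- c"] by auto
    ultimately show "finite ((+) c ` S \<inter> \<Lambda>)" by simp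
  qed
next
  fix A :: "'b set" assume "A \<in> sets borel" "bounded A"
  then show "(\<lambda>S. card ((+) c ` S \<inter> A)) \<in> config_space \<rightarrow>\<^sub>M count_space UNIV"
    unfolding card_translate_Int by (intro measurable_card_Int borel_bounded_translate)
qed

context poisson_process
begin

lemma prob_cards_translate:
  assumes I: "finite I" and A: "\<And>i. i \<in> I \<Longrightarrow> A i \<in> sets borel" "\<And>i. i \<in> I \<Longrightarrow> bounded (A i)"
  shows "prob {S \<in> configurations. \<forall>i\<in>I. card (S \<inter> (+) c ` A i) = k i}
    = prob {S \<in> configurations. \<forall>i\<in>I. card (S \<inter> A i) = k i}"
proof (rule prob_cards_cong[OF I])
  fix J assume J: "J \<subseteq> I" "J \<noteq> {}"
  have "x \<in> (+) c ` B \<longleftrightarrow> x - c \<in> B" for x :: 'b and B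
    unfolding translate_eq_vimage by simp
  then have "atom I (\<lambda>i. (+) c ` A i) J = (+) c ` atom I A J"
    unfolding set_eq_iff by (simp add: atom_def)
  then show "measure lborel (atom I (\<lambda>i. (+) c ` A i) J) = measure lborel (atom I A J)"
    using atom_borel_bounded[OF I A J] by (simp add: measure_lborel_translate)
qed (simp_all add: A borel_bounded_translate)

lemma translate_measurable_N: "(`) ((+) c) \<in> N \<rightarrow>\<^sub>M N"
  unfolding measurable_cong_sets[OF sets_N sets_N] by (rule translate_measurable)

text \<open>Prescribing the counts in finitely many bounded sets gives a generator of the configuration space that is stable under
  intersections, and translation preserves the probabilities of these events.\<close>

lemma distr_translate: "distr N N ((`) ((+) c)) = N"
proof -
  define \<E> where "\<E> = {{S \<in> configurations. \<forall>i\<in>F. card (S \<inter> fst i) = snd i} | F :: ('b set \<times> nat) set.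
    finite F \<and> (\<forall>i\<in>F. fst i \<in> sets borel \<and> bounded (fst i))}"
  note meas = translate_measurable_N[of c]
  show ?thesis
  proof (rule measure_eqI_generator_eq[where \<Omega>=configurations and E=\<E> and A="\<lambda>_. configurations"])
    show "Int_stable \<E>"
    proof (rule Int_stableI)
      fix X Y assume "X \<in> \<E>" "Y \<in> \<E>"
      then obtain F G where "X = {S \<in> configurations. \<forall>i\<in>F. card (S \<inter> fst i) = snd i}"
        "Y = {S \<in> configurations. \<forall>i\<in>G. card (S \<inter> fst i) = snd i}"
        "finite (F \<union> G)" "\<forall>i\<in>F \<union> G. fst i \<in> sets borel \<and> bounded (fst i)"
        unfolding \<E>_def by blast
      then show "X \<inter> Y \<in> \<E>"
        unfolding \<E>_def mem_Collect_eq by (intro exI[of _ "F \<union> G"]) auto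
    qed
    show "\<E> \<subseteq> Pow configurations" by (auto simp: \<E>_def)
    have "X \<in> sets config_space" if "X \<in> \<E>" for X
    proof -
      from that obtain F where X: "X = {S \<in> configurations. \<forall>i\<in>F. card (S \<inter> fst i) = snd i}"
        and F: "finite F" "\<forall>i\<in>F. fst i \<in> sets borel \<and> bounded (fst i)"
        unfolding \<E>_def by blast
      have "{S \<in> space config_space. \<forall>i\<in>F. card (S \<inter> fst i) = snd i} \<in> sets config_space"
      proof (rule sets.sets_Collect_finite_All[OF _ F(1)])
        fix i assume "i \<in> F"
        then have "(\<lambda>S. card (S \<inter> fst i)) -` {snd i} \<inter> space config_space \<in> sets config_space"
          using F(2) by (intro measurable_sets[OF measurable_card_Int]) auto
        then show "{S \<in> space config_space. card (S \<inter> fst i) = snd i} \<in> sets config_space"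
          by (simp add: vimage_def Int_def conj_commute)
      qed
      then show ?thesis by (simp add: X)
    qed
    moreover have "{S \<in> configurations. card (S \<inter> A) = k} \<in> \<E>" if "A \<in> sets borel" "bounded A" for A k
      unfolding \<E>_def mem_Collect_eq using that by (intro exI[of _ "{(A, k)}"]) auto
    ultimately have "sets config_space = sigma_sets configurations \<E>"
      unfolding sets_config_space by (intro sigma_sets_eqI) (auto intro: sigma_sets.Basic)
    then show "sets N = sigma_sets configurations \<E>" "sets (distr N N ((`) ((+) c))) = sigma_sets configurations \<E>"
      by (simp_all add: sets_N)
    show "range (\<lambda>_. configurations) \<subseteq> \<E>"
      unfolding \<E>_def by (auto intro!: exI[of _ "{}"])
    show "(\<Union>i::nat. configurations) = configurations" by simp
    show "emeasure (distr N N ((`) ((+) c))) configurations \<noteq> \<infinity>"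
      using prob_space.emeasure_space_1[OF prob_space_distr[OF meas]] by simp
    fix X assume "X \<in> \<E>"
    then obtain F where X: "X = {S \<in> configurations. \<forall>i\<in>F. card (S \<inter> fst i) = snd i}"
      and F: "finite F" "\<forall>i\<in>F. fst i \<in> sets borel \<and> bounded (fst i)"
      unfolding \<E>_def by blast
    have "X \<in> sets N"
      using \<open>X \<in> \<E>\<close> \<open>sets N = sigma_sets configurations \<E>\<close> by (simp add: sigma_sets.Basic)
    have "(`) ((+) c) -` X \<inter> space N
        = {S \<in> configurations. \<forall>i\<in>F. card (S \<inter> (+) (- c) ` fst i) = snd i}"
      using measurable_space[OF meas] by (auto simp: X card_translate_Int)
    also have "prob \<dots> = prob X"
      using F prob_cards_translate[of F fst "- c" snd] by (simp add: X)
    finally show "emeasure (distr N N ((`) ((+) c))) X = emeasure N X"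
      using meas \<open>X \<in> sets N\<close> by (simp add: emeasure_distr emeasure_eq_measure)
  qed
qed

end

section \<open>Almost sure and quantitative covering\<close>

lemma measure_lborel_cell:
  fixes c :: "'a::euclidean_space"
  assumes "a \<le> b"
  shows "measure lborel (cell c a b) = measure lborel (ball (0::'a) (1/2)) * (b - a)"
proof -
  have "emeasure lborel (cell c a b) = emeasure lborel (ball c (1/2)) * emeasure lborel {a<..b}"
    unfolding cell_def lborel_prod[symmetric]
    by (rule lborel.emeasure_pair_measure_Times) auto
  then have "measure lborel (cell c a b) = measure lborel (ball c (1/2)) * (b - a)"
    using assms by (simp add: measure_def enn2real_mult)
  moreover have "measure lborel (ball c (1/2)) = measure lborel (ball (0::'a) (1/2))"
    using measure_lborel_translate[of "ball 0 (1/2)" c] by simp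
  ultimately show ?thesis by simp
qed

text \<open>The semigroup and the stationary expectation integrate functions whose measurability is only
  known up to null sets; this exchanges them for measurable versions.\<close>

lemma integral_completion_cong_AE:
  fixes g h :: "'x \<Rightarrow> real"
  assumes h: "h \<in> borel_measurable M" and eq: "AE x in M. g x = h x"
  shows "(\<integral>x. g x \<partial>completion M) = (\<integral>x. h x \<partial>M)"
proof -
  have h': "h \<in> borel_measurable (completion M)" by (rule measurable_completion[OF h])
  have eq': "AE x in completion M. g x = h x" using eq by (rule AE_completion)
  have "g \<in> borel_measurable (completion M)"
  proof (rule measurableI)
    fix B :: "real set" assume "B \<in> sets borel"
    then have 1: "h -` B \<inter> space (completion M) \<in> sets (completion M)"
      using h' by (rule measurable_sets[rotated])
    have 2: "AE x in completion M. x \<in> h -` B \<inter> space (completion M) \<longleftrightarrow> x \<in> g -` B \<inter> space (completion M)"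
      using eq' by eventually_elim auto
    show "g -` B \<inter> space (completion M) \<in> sets (completion M)"
      by (rule completion.in_sets_AE[OF 2 1]) simp
  qed simp
  then have "(\<integral>x. g x \<partial>completion M) = (\<integral>x. h x \<partial>completion M)"
    using h' eq' by (rule integral_cong_AE)
  then show ?thesis by (simp add: integral_completion[OF h])
qed

lemma (in prob_space) integral_diff_le_prob:
  fixes g h :: "'a \<Rightarrow> real"
  assumes meas: "g \<in> borel_measurable M" "h \<in> borel_measurable M"
    and bounds: "AE x in M. \<bar>g x\<bar> \<le> c" "AE x in M. \<bar>h x\<bar> \<le> c"
    and E: "E \<in> events" and eq: "AE x in M. x \<notin> E \<longrightarrow> g x = h x"
  shows "\<bar>expectation g - expectation h\<bar> \<le> 2 * c * prob E"
proof -
  have int: "integrable M g" "integrable M h"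
    using bounds by (auto intro!: integrable_const_bound[where B=c] meas)
  have ind: "integrable M (indicator E :: _ \<Rightarrow> real)"
    by (rule integrable_real_indicator[OF E]) (simp add: emeasure_eq_measure)
  have "expectation g - expectation h = expectation (\<lambda>x. g x - h x)"
    using int by simp
  also have "\<bar>\<dots>\<bar> \<le> expectation (\<lambda>x. \<bar>g x - h x\<bar>)"
    by (rule integral_abs_bound)
  also have "\<dots> \<le> expectation (\<lambda>x. 2 * c * indicator E x)"
  proof (rule integral_mono_AE)
    show "AE x in M. \<bar>g x - h x\<bar> \<le> 2 * c * indicator E x"
      using bounds eq by eventually_elim (auto simp: indicator_def)
  qed (use int ind in auto)
  also have "\<dots> = 2 * c * prob E" using E by simp
  finally show ?thesis .
qed

locale space_time_poisson = poisson_process N l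
  for N :: "('a::euclidean_space \<times> real) set measure" and l :: real +
  assumes intensity_pos: "0 < l"
begin

lemma cell_borel_bounded: "cell c a b \<in> sets (borel :: ('a \<times> real) measure)" "bounded (cell c a b)"
proof -
  have "bounded {a<..b}" by (rule bounded_subset[of "{a..b}"]) auto
  then show "bounded (cell c a b)" unfolding cell_def by (intro bounded_Times) auto
  show "cell c a b \<in> sets (borel :: ('a \<times> real) measure)"
    unfolding cell_def by (intro borel_Times) auto
qed

lemma AE_configuration: "AE S in N. S \<in> configurations"
  by (rule AE_I2) simp

text \<open>The cell has height \<open>m\<close>, so it is empty with a probability that decays geometrically in \<open>m\<close>; the base point
  may move with \<open>m\<close>, which serves both the future and the past.\<close>

lemma AE_cell_hit: "AE S in N. \<exists>m::nat. S \<inter> cell c (u m) (u m + real m) \<noteq> {}"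
proof -
  define E where "E m = {S \<in> configurations. S \<inter> cell c (u m) (u m + real m) = {}}" for m :: nat
  have E: "E m \<in> events" "prob (E m) = exp (- (l * measure lborel (ball (0::'a) (1/2)))) ^ m" for m
    using prob_void[OF cell_borel_bounded, of c "u m" "u m + real m"]
    by (simp_all add: E_def measure_lborel_cell exp_of_nat_mult[symmetric] mult_ac)
  have "exp (- (l * measure lborel (ball (0::'a) (1/2)))) < 1" using content_ball_pos[of "1/2" "0::'a"] intensity_pos by simp
  then have "(\<lambda>m. exp (- (l * measure lborel (ball (0::'a) (1/2)))) ^ m) \<longlonglongrightarrow> 0" by (intro LIMSEQ_realpow_zero) auto
  moreover have "prob (\<Inter>m. E m) \<le> exp (- (l * measure lborel (ball (0::'a) (1/2)))) ^ m" for m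
    using finite_measure_mono[of "\<Inter>m. E m" "E m"] E by auto
  ultimately have "prob (\<Inter>m. E m) \<le> 0"
    by (intro LIMSEQ_le_const) auto
  moreover have "(\<Inter>m. E m) \<in> events" using E(1) by blast
  ultimately have "AE S in N. S \<notin> (\<Inter>m. E m)"
    using prob_eq_0 by (simp add: measure_le_0_iff)
  with AE_configuration show ?thesis
    by eventually_elim (auto simp: E_def)
qed

lemma AE_unbounded_future: "AE S in N. unbounded_future S"
proof -
  obtain D :: "'a set" where D: "countable D"
    "\<And>\<Lambda>. bounded \<Lambda> \<Longrightarrow> \<exists>F. finite F \<and> F \<subseteq> D \<and> \<Lambda> \<subseteq> (\<Union>c\<in>F. ball c (1/2))"
    by (rule countable_half_ball_cover) blast
  have "AE S in N. \<forall>c\<in>D. \<forall>n::nat. \<exists>m::nat. S \<inter> cell c (real n) (real n + real m) \<noteq> {}"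
    using AE_cell_hit by (simp add: AE_ball_countable[OF D(1)] AE_all_countable)
  then show ?thesis
  proof eventually_elim
    case (elim S)
    show ?case unfolding unbounded_future_def
    proof (intro allI)
      fix x :: 'a and r :: real
      obtain n :: nat where n: "r \<le> real n" using real_arch_simple by blast
      obtain c where c: "c \<in> D" "x \<in> ball c (1/2)" using D(2)[of "{x}"] by auto
      with elim obtain m :: nat where "S \<inter> cell c (real n) (real n + real m) \<noteq> {}" by blast
      then have "covered {c} (real n) (real n + real m) S" by (simp add: covered_def)
      from covered_absorbs[OF this, of "(x, r)"] c n
      show "\<exists>q\<in>S. norm (x - fst q) \<le> 1 \<and> r < snd q" by (auto simp: absorbs_def)
    qed
  qed
qed

lemma AE_covered_past:
  "AE S in N. \<forall>\<Lambda>. bounded \<Lambda> \<longrightarrow> (\<exists>F a. \<Lambda> \<subseteq> (\<Union>c\<in>F. ball c (1/2)) \<and> covered F a 0 S)"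
proof -
  obtain D :: "'a set" where D: "countable D"
    "\<And>\<Lambda>. bounded \<Lambda> \<Longrightarrow> \<exists>F. finite F \<and> F \<subseteq> D \<and> \<Lambda> \<subseteq> (\<Union>c\<in>F. ball c (1/2))"
    by (rule countable_half_ball_cover) blast
  have "AE S in N. \<forall>c\<in>D. \<exists>m::nat. S \<inter> cell c (- real m) 0 \<noteq> {}"
    using AE_cell_hit[of _ "\<lambda>m. - real m"] by (simp add: AE_ball_countable[OF D(1)])
  then show ?thesis
  proof eventually_elim
    case (elim S)
    then obtain m :: "'a \<Rightarrow> nat" where m: "\<And>c. c \<in> D \<Longrightarrow> S \<inter> cell c (- real (m c)) 0 \<noteq> {}"
      by metis
    show ?case
    proof (intro allI impI)
      fix \<Lambda> :: "'a set" assume "bounded \<Lambda>"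
      then obtain F where F: "finite F" "F \<subseteq> D" "\<Lambda> \<subseteq> (\<Union>c\<in>F. ball c (1/2))"
        using D(2)[OF \<open>bounded \<Lambda>\<close>] by blast
      have "covered F (- real (\<Sum>c\<in>F. m c)) 0 S"
        unfolding covered_def
      proof
        fix c assume c: "c \<in> F"
        then have "m c \<le> (\<Sum>c\<in>F. m c)" using F(1) by (intro member_le_sum) auto
        then have "real (m c) \<le> real (\<Sum>c\<in>F. m c)" by (rule of_nat_mono)
        then have "cell c (- real (m c)) 0 \<subseteq> cell c (- real (\<Sum>c\<in>F. m c)) 0" by (auto simp: cell_def)
        then show "S \<inter> cell c (- real (\<Sum>c\<in>F. m c)) 0 \<noteq> {}" using m[of c] c F(2) by blast
      qed
      with F(3) show "\<exists>F a. \<Lambda> \<subseteq> (\<Union>c\<in>F. ball c (1/2)) \<and> covered F a 0 S" by blast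
    qed
  qed
qed

text \<open>A union bound over the balls; this is where the exponential rate enters.\<close>

lemma prob_not_covered:
  assumes "finite F" "a \<le> b"
  shows "{S \<in> configurations. \<not> covered F a b S} \<in> events"
    and "prob {S \<in> configurations. \<not> covered F a b S} \<le> card F * exp (- (l * measure lborel (ball (0::'a) (1/2)) * (b - a)))"
proof -
  let ?E = "\<lambda>c. {S \<in> configurations. S \<inter> cell c a b = {}}"
  have eq: "{S \<in> configurations. \<not> covered F a b S} = (\<Union>c\<in>F. ?E c)"
    by (auto simp: covered_def)
  have E: "?E c \<in> events" "prob (?E c) = exp (- (l * measure lborel (ball (0::'a) (1/2)) * (b - a)))" for c
    using prob_void[OF cell_borel_bounded, of c a b] assms(2)
    by (simp_all add: measure_lborel_cell mult_ac)
  then show "{S \<in> configurations. \<not> covered F a b S} \<in> events"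
    unfolding eq using assms(1) by (intro sets.finite_UN) auto
  have "prob (\<Union>c\<in>F. ?E c) \<le> (\<Sum>c\<in>F. prob (?E c))"
    using assms(1) E(1) by (intro finite_measure_subadditive_finite) auto
  also have "(\<Sum>c\<in>F. prob (?E c)) = card F * exp (- (l * measure lborel (ball (0::'a) (1/2)) * (b - a)))"
    by (subst sum.cong[OF refl E(2)]) simp
  finally show "prob {S \<in> configurations. \<not> covered F a b S} \<le> card F * exp (- (l * measure lborel (ball (0::'a) (1/2)) * (b - a)))"
    unfolding eq .
qed

section \<open>Exponential convergence\<close>

context
  fixes f :: "'a set \<Rightarrow> real" and \<Lambda> :: "'a set" and F :: "'a set" and M :: real
  assumes f_measurable: "f \<in> borel_measurable config_space"
    and f_bound: "\<And>\<eta>. \<eta> \<in> configurations \<Longrightarrow> \<bar>f \<eta>\<bar> \<le> M"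
    and f_support: "\<And>\<eta>. \<eta> \<in> configurations \<Longrightarrow> f \<eta> = f (\<eta> \<inter> \<Lambda>)"
    and support_bounded: "bounded \<Lambda>"
    and F: "finite F" "\<Lambda> \<subseteq> (\<Union>c\<in>F. ball c (1/2))"
begin

lemma f_cong:
  assumes "\<eta> \<in> configurations" "\<eta>' \<in> configurations" "\<eta> \<inter> \<Lambda> = \<eta>' \<inter> \<Lambda>"
  shows "f \<eta> = f \<eta>'"
  using f_support[OF assms(1)] f_support[OF assms(2)] assms(3) by simp

lemma f_survivors_measurable: "(\<lambda>S. f (survivors a t S)) \<in> borel_measurable N"
  unfolding measurable_N by (rule measurable_compose[OF survivors_measurable f_measurable])

text \<open>When the window is covered during \<open>(0, t]\<close>, the initial configuration has been forgotten.\<close>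

lemma semigroup_close_to_survivors:
  assumes \<eta>: "\<eta> \<in> configurations" and t: "0 \<le> t"
  shows "\<bar>transition_semigroup N t f \<eta> - expectation (\<lambda>S. f (survivors 0 t S))\<bar>
    \<le> 2 * M * (card F * exp (- (l * measure lborel (ball (0::'a) (1/2)) * t)))"
proof -
  let ?g = "\<lambda>S. f (survivors 0 t (S \<union> \<eta> \<times> {0}))"
  have \<eta>0: "\<eta> \<times> {0::real} \<in> configurations" using \<eta> by (rule configurations_time_slice)
  have g: "?g \<in> borel_measurable N"
    unfolding measurable_N
    by (rule measurable_compose[OF measurable_compose[OF measurable_Un_configuration[OF \<eta>0]
          survivors_measurable] f_measurable])
  have "AE S in N. f (process_from \<eta> t S) = ?g S"
    using AE_configuration AE_unbounded_future
    by eventually_elim (simp add: process_from_eq_survivors t)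
  then have eq: "transition_semigroup N t f \<eta> = expectation ?g"
    unfolding transition_semigroup_def by (rule integral_completion_cong_AE[OF g])
  have "\<bar>expectation ?g - expectation (\<lambda>S. f (survivors 0 t S))\<bar>
      \<le> 2 * M * prob {S \<in> configurations. \<not> covered F 0 t S}"
  proof (rule integral_diff_le_prob[OF g f_survivors_measurable])
    show "AE S in N. \<bar>?g S\<bar> \<le> M" "AE S in N. \<bar>f (survivors 0 t S)\<bar> \<le> M"
      using AE_configuration
      by (eventually_elim, auto intro!: f_bound survivors_configurations configurations_Un \<eta>0)+
    show "AE S in N. S \<notin> {S \<in> configurations. \<not> covered F 0 t S} \<longrightarrow> ?g S = f (survivors 0 t S)"
      using AE_configuration
    proof eventually_elim
      case (elim S)
      show ?case
      proof
        assume "S \<notin> {S \<in> configurations. \<not> covered F 0 t S}"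
        with elim have "covered F 0 t S" by simp
        then have "survivors 0 t S \<inter> \<Lambda> = survivors 0 t (S \<union> \<eta> \<times> {0}) \<inter> \<Lambda>"
          by (rule survivors_covered_cong[OF _ F(2)]) auto
        then show "?g S = f (survivors 0 t S)"
          using elim by (intro f_cong survivors_configurations configurations_Un \<eta>0) auto
      qed
    qed
  qed (use prob_not_covered F(1) t in auto)
  also have "\<dots> \<le> 2 * M * (card F * exp (- (l * measure lborel (ball (0::'a) (1/2)) * t)))"
    using prob_not_covered(2)[OF F(1) t] f_bound[of "{}"]
    by (intro mult_left_mono) (auto simp: configurations_def)
  finally show ?thesis unfolding eq .
qed

text \<open>When the window is covered during \<open>(-t, 0]\<close>, points before \<open>-t\<close> have been forgotten. A measurable version of
  the integrand is the limit over starting times tending to \<open>-\<infinity>\<close>, which is eventually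
  constant as the window is almost surely covered by some finite stretch of the past.\<close>

lemma stationary_close_to_survivors:
  assumes t: "0 \<le> t"
  shows "\<bar>stationary_expectation N f - expectation (\<lambda>S. f (survivors (- t) 0 S))\<bar>
    \<le> 2 * M * (card F * exp (- (l * measure lborel (ball (0::'a) (1/2)) * t)))"
proof -
  let ?g = "\<lambda>S. lim (\<lambda>n. f (survivors (- real n) 0 S))"
  have g: "?g \<in> borel_measurable N"
    by (rule borel_measurable_lim_metric[where f="\<lambda>n S. f (survivors (- real n) 0 S)"])
      (rule f_survivors_measurable)
  have conf: "AE S in N. stationary_config S \<in> configurations"
    using AE_configuration AE_unbounded_future AE_covered_past
  proof eventually_elim
    case (elim S)
    have "finite (stationary_config S \<inter> A)" if A: "bounded A" for A
    proof -
      obtain G a where "A \<subseteq> (\<Union>c\<in>G. ball c (1/2))" "covered G a 0 S"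
        using elim(3)[rule_format, OF A] by blast
      then have "stationary_config S \<inter> A = survivors a 0 S \<inter> A"
        using elim(1,2) by (intro stationary_config_Int) auto
      then show ?thesis
        using finite_configuration_Int[OF survivors_configurations A] elim(1) by simp
    qed
    then show ?case by (simp add: configurations_def)
  qed
  have AE_g: "AE S in N. f (stationary_config S) = ?g S"
    using AE_configuration AE_unbounded_future AE_covered_past conf
  proof eventually_elim
    case (elim S)
    obtain G a where G: "\<Lambda> \<subseteq> (\<Union>c\<in>G. ball c (1/2))" "covered G a 0 S"
      using elim(3)[rule_format, OF support_bounded] by blast
    obtain m where m: "- a \<le> real m" using real_arch_simple by blast
    have "f (survivors (- real n) 0 S) = f (stationary_config S)" if "m \<le> n" for n
    proof (rule f_cong)
      have "- real n \<le> a" using m that by linarith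
      then show "survivors (- real n) 0 S \<inter> \<Lambda> = stationary_config S \<inter> \<Lambda>"
        using stationary_config_Int[OF elim(1,2) G(2,1)] by simp
    qed (use elim survivors_configurations in auto)
    then have "(\<lambda>n. f (survivors (- real n) 0 S)) \<longlonglongrightarrow> f (stationary_config S)"
      by (intro tendsto_eventually) (auto simp: eventually_sequentially)
    then show ?case by (simp add: limI)
  qed
  then have eq: "stationary_expectation N f = expectation ?g"
    unfolding stationary_expectation_def by (rule integral_completion_cong_AE[OF g])
  have "\<bar>expectation ?g - expectation (\<lambda>S. f (survivors (- t) 0 S))\<bar>
      \<le> 2 * M * prob {S \<in> configurations. \<not> covered F (- t) 0 S}"
  proof (rule integral_diff_le_prob[OF g f_survivors_measurable])
    show "AE S in N. \<bar>?g S\<bar> \<le> M"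
      using AE_g conf by eventually_elim (metis f_bound)
    show "AE S in N. \<bar>f (survivors (- t) 0 S)\<bar> \<le> M"
      using AE_configuration by eventually_elim (auto intro!: f_bound survivors_configurations)
    show "AE S in N. S \<notin> {S \<in> configurations. \<not> covered F (- t) 0 S} \<longrightarrow> ?g S = f (survivors (- t) 0 S)"
      using AE_configuration AE_unbounded_future AE_g conf
    proof eventually_elim
      case (elim S)
      show ?case
      proof
        assume "S \<notin> {S \<in> configurations. \<not> covered F (- t) 0 S}"
        with elim have "covered F (- t) 0 S" by simp
        then have "stationary_config S \<inter> \<Lambda> = survivors (- t) 0 S \<inter> \<Lambda>"
          by (rule stationary_config_Int[OF elim(1,2) _ F(2)]) simp
        then have "f (stationary_config S) = f (survivors (- t) 0 S)"
          using elim by (intro f_cong survivors_configurations)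
        then show "?g S = f (survivors (- t) 0 S)" using elim(3) by simp
      qed
    qed
  qed (use prob_not_covered F(1) t in auto)
  also have "\<dots> \<le> 2 * M * (card F * exp (- (l * measure lborel (ball (0::'a) (1/2)) * t)))"
    using prob_not_covered(2)[OF F(1), of "- t" 0] t f_bound[of "{}"]
    by (intro mult_left_mono) (auto simp: configurations_def)
  finally show ?thesis unfolding eq .
qed

lemma expectation_survivors_translate:
  "expectation (\<lambda>S. f (survivors (- t) 0 S)) = expectation (\<lambda>S. f (survivors 0 t S))"
proof -
  have "(\<integral>S. f (survivors 0 t S) \<partial>distr N N ((`) ((+) (0, t))))
      = expectation (\<lambda>S. f (survivors 0 t ((+) (0, t) ` S)))"
    by (rule integral_distr[OF translate_measurable_N f_survivors_measurable])
  moreover have "survivors 0 t ((+) (0, t) ` S) = survivors (- t) 0 S" for S :: "('a \<times> real) set"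
    using survivors_translate[of "- t" t 0 S] by simp
  ultimately show ?thesis by (simp add: distr_translate)
qed

lemma semigroup_close_to_stationary:
  assumes "\<eta> \<in> configurations" "0 \<le> t"
  shows "\<bar>transition_semigroup N t f \<eta> - stationary_expectation N f\<bar>
    \<le> 4 * M * card F * exp (- (measure lborel (ball (0::'a) (1/2)) * l * t))"
proof -
  let ?e = "2 * M * (card F * exp (- (l * measure lborel (ball (0::'a) (1/2)) * t)))"
  have "\<bar>p - q\<bar> \<le> ?e + ?e" if "\<bar>p - r\<bar> \<le> ?e" "\<bar>q - r\<bar> \<le> ?e" for p q r :: real
    using that by linarith
  from this[OF semigroup_close_to_survivors[OF assms, unfolded expectation_survivors_translate[symmetric]]
      stationary_close_to_survivors[OF assms(2)]]
  have "\<bar>transition_semigroup N t f \<eta> - stationary_expectation N f\<bar> \<le> ?e + ?e" .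
  also have "?e + ?e = 4 * M * card F * exp (- (measure lborel (ball (0::'a) (1/2)) * l * t))"
    by (simp add: mult.commute[of l])
  finally show ?thesis .
qed

end

end

theorem corollary4p2:
  shows "\<exists>C>0::real. \<forall>l>0. \<forall>N :: ('a::euclidean_space \<times> real) set measure. poisson_law l N \<longrightarrow>
    (\<forall>f :: 'a set \<Rightarrow> real.
       f \<in> borel_measurable config_space \<and> bounded (f ` configurations) \<and> finite_support f \<longrightarrow>
       (\<exists>K::real. \<forall>t\<ge>0.
          sup_norm (\<lambda>\<eta>. transition_semigroup N t f \<eta> - stationary_expectation N f)
            \<le> ereal (K * exp (- (C * l * t)))))"
proof (rule exI[of _ "measure lborel (ball (0::'a) (1/2))"], intro conjI allI impI)
  show "0 < measure lborel (ball (0::'a) (1/2))" by (rule content_ball_pos) simp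
next
  fix l :: real and N :: "('a \<times> real) set measure" and f :: "'a set \<Rightarrow> real"
  assume l: "0 < l" and N: "poisson_law l N"
    and f: "f \<in> borel_measurable config_space \<and> bounded (f ` configurations) \<and> finite_support f"
  from N have "prob_space N" by (simp add: poisson_law_def)
  then interpret space_time_poisson N l
    using l N by (simp add: space_time_poisson_def poisson_process_def
      poisson_process_axioms_def space_time_poisson_axioms_def)
  obtain M where M: "\<And>\<eta>. \<eta> \<in> configurations \<Longrightarrow> \<bar>f \<eta>\<bar> \<le> M"
    using f by (auto simp: bounded_iff)
  obtain \<Lambda> where \<Lambda>: "bounded \<Lambda>" "\<And>\<eta>. \<eta> \<in> configurations \<Longrightarrow> f \<eta> = f (\<eta> \<inter> \<Lambda>)"
    using f unfolding finite_support_def by blast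
  obtain D :: "'a set" where D: "countable D"
    "\<And>\<Lambda>. bounded \<Lambda> \<Longrightarrow> \<exists>F. finite F \<and> F \<subseteq> D \<and> \<Lambda> \<subseteq> (\<Union>c\<in>F. ball c (1/2))"
    by (rule countable_half_ball_cover) blast
  from D(2)[OF \<Lambda>(1)] obtain F where F: "finite F" "\<Lambda> \<subseteq> (\<Union>c\<in>F. ball c (1/2))" by blast
  show "\<exists>K. \<forall>t\<ge>0. sup_norm (\<lambda>\<eta>. transition_semigroup N t f \<eta> - stationary_expectation N f)
      \<le> ereal (K * exp (- (measure lborel (ball (0::'a) (1/2)) * l * t)))"
    using semigroup_close_to_stationary[OF conjunct1[OF f] M \<Lambda>(2,1) F]
    by (intro exI[of _ "4 * M * card F"]) (auto simp: sup_norm_def intro!: SUP_least)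
qed

end
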